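(* Let $M$ be a differentiable manifold and let $S$ be an $S$-transport along paths in the tensor algebra over $M$ satisfying $$S^{\gamma|J'}_{s\to t}=S^\gamma_{s\to t},\qquad s,t\in J',$$ where $\gamma|J'$ is the restriction of $\gamma:J\to M$ to the subinterval $J'$ of $J$, and $$S^{\gamma\circ\tau}_{s\to t}=S^\gamma_{\tau(s)\to\tau(t)},\qquad s,t\in J'',$$ where $\gamma:J\to M$ and $\tau:J''\to J$ is a one-to-one map from the interval $J''$ onto $J$. Then the $S$-parallel transport generated by $S$ is an axiomatically defined parallel transport.
   Context: All real intervals are closed, i.e. of the form $[a,b]$ with $a\le b$. Paths $\gamma:J\to M$ are of class $C^1$. $T_x(M)$ here denotes the tensor algebra at $x\in M$. $\mathrm{Diff}(X,Y)$ is the set of diffeomorphisms from $X$ onto $Y$. An $S$-transport along paths $S$ (a transport along paths generated by derivations of the tensor algebra over $M$) assigns to every path $\gamma:J\to M$ maps $S^\gamma_{s\to t}:T_{\gamma(s)}(M)\to T_{\gamma(t)}(M)$, $s,t\in J$, which are $\mathbb{R}$-linear, satisfy $S^\gamma_{s\to t}(A\otimes B)=S^\gamma_{s\to t}(A)\otimes S^\gamma_{s\to t}(B)$, commute with contractions, act as the identity on scalars, and satisfy $S^\gamma_{t\to r}\circ S^\gamma_{s\to t}=S^\gamma_{s\to r}$ and $S^\gamma_{s\to s}=\mathrm{id}$ for $r,s,t\in J$. The $S$-parallel transport generated by $S$ is the map $\varphi$ from the set of $C^1$ paths in $M$ given by $\varphi:\eta\mapsto\varphi_\eta:=S^\eta_{a\to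 b}:T_{\eta(a)}(M)\to T_{\eta(b)}(M)$ for $\eta:[a,b]\to M$, $a\le b$. For $\gamma:[0,1]\to M$ the (canonical) inverse path is $\gamma_-(s):=\gamma(1-s)$, $s\in[0,1]$. For $\gamma_1,\gamma_2:[0,1]\to M$ with $\gamma_1(1)=\gamma_2(0)$ the (canonical) product is $(\gamma_1\gamma_2)(s):=\gamma_1(2s)$ for $s\in[0,1/2]$ and $(\gamma_1\gamma_2)(s):=\gamma_2(2s-1)$ for $s\in[1/2,1]$. An axiomatically defined parallel transport (here with fibres $T_x(M)$, $x\in M$) is a map $\varphi:\gamma\mapsto\varphi_\gamma$ defined on the set of $C^1$ paths in $M$ such that, for $\gamma:[a,b]\to M$, $\varphi_\gamma\in\mathrm{Diff}(T_{\gamma(a)}(M),T_{\gamma(b)}(M))$, and: (1) $\varphi_{\gamma\circ\tau}=\varphi_\gamma$ for $\gamma:[a,b]\to M$ and every orientation preserving diffeomorphism $\tau:[c,d]\to[a,b]$, $c\le d$; (2) $\varphi_{\gamma_-}=(\varphi_\gamma)^{-1}$ for $\gamma:[0,1]\to M$; (3) $\varphi_{\gamma_1\gamma_2}=\varphi_{\gamma_2}\circ\varphi_{\gamma_1}$ for $\gamma_1,\gamma_2:[0,1]\to M$ with $\gamma_1(1)=\gamma_2(0)$; (4) $\varphi_{\gamma_a}=\mathrm{id}$ (on $T_{x_a}(M)$) for every one-point path $\gamma_a:\{a\}\to\{x_a\}$, $x_a\in M$, $a\in\mathbb{R}$. *)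

theory Defs
  imports "HOL-Analysis.Analysis" "HOL-Library.Function_Algebras" "HOL-Library.Extended_Nat"
begin

text \<open>
  Tangent vectors, covectors and tensors are all encoded as functions, so that the fibres at the
  points of the manifold are linear subspaces, under the pointwise operations, of a single type.
\<close>

instantiation "fun" :: (type, real_vector) real_vector
begin

definition scaleR_fun :: "real \<Rightarrow> ('a \<Rightarrow> 'b) \<Rightarrow> 'a \<Rightarrow> 'b" where
  "scaleR_fun r f = (\<lambda>x. r *\<^sub>R f x)"

instance
  by standard (simp_all add: scaleR_fun_def plus_fun_def fun_eq_iff scaleR_add_right scaleR_add_left)

end

definition linear_on :: "'a::real_vector set \<Rightarrow> ('a \<Rightarrow> 'b::real_vector) \<Rightarrow> bool" where
  "linear_on V f \<longleftrightarrow>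
     (\<forall>x\<in>V. \<forall>y\<in>V. f (x + y) = f x + f y) \<and> (\<forall>r. \<forall>x\<in>V. f (r *\<^sub>R x) = r *\<^sub>R f x)"


section \<open>Manifolds\<close>

text \<open>
  Continuous differentiability of order \<open>n\<close> on an open set \<open>U\<close>. The domain is meant to be
  finite-dimensional, so that continuity of the derivative amounts to continuity of all
  directional derivatives.
\<close>

primrec Ck_on :: "nat \<Rightarrow> 'a::real_normed_vector set \<Rightarrow> ('a \<Rightarrow> 'b::real_normed_vector) \<Rightarrow> bool" where
  "Ck_on 0 U f \<longleftrightarrow> continuous_on U f"
| "Ck_on (Suc n) U f \<longleftrightarrow>
     (\<forall>x\<in>U. f differentiable (at x)) \<and> (\<forall>v. Ck_on n U (\<lambda>x. frechet_derivative f (at x) v))"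

type_synonym ('m, 'e) chart = "'m set \<times> ('m \<Rightarrow> 'e)"

text \<open>
  \<open>A\<close> is an atlas of class \<open>C^k\<close>, where \<open>1 \<le> k \<le> \<infinity>\<close>, for the whole (Hausdorff) type \<open>'m\<close>. The model
  space is an arbitrary finite-dimensional normed space and not a \<open>euclidean_space\<close>, because that
  class excludes dimension 0. A chart \<open>(U, c)\<close> is unconstrained outside its domain \<open>U\<close>.
\<close>

definition differentiable_manifold ::
    "enat \<Rightarrow> ('m::t2_space, 'e::real_normed_vector) chart set \<Rightarrow> bool" where
  "differentiable_manifold k A \<longleftrightarrow>
     1 \<le> k \<and>
     (\<exists>B::'e set. finite B \<and> span B = UNIV) \<and>
     (\<Union>(U, c)\<in>A. U) = UNIV \<and>
     (\<forall>(U, c)\<in>A. open U \<and> open (c ` U) \<and> homeomorphism U (c ` U) c (inv_into U c)) \<and>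
     (\<forall>(U, c)\<in>A. \<forall>(V, d)\<in>A. \<forall>n. enat n \<le> k \<longrightarrow>
        Ck_on n (c ` (U \<inter> V)) (\<lambda>y. d (inv_into U c y)))"

text \<open>One-sided derivatives are used at the end points of the interval \<open>J\<close>.\<close>

definition C1_within :: "real set \<Rightarrow> real set \<Rightarrow> (real \<Rightarrow> 'a::real_normed_vector) \<Rightarrow> bool" where
  "C1_within J T f \<longleftrightarrow>
     (\<exists>f'. continuous_on T f' \<and> (\<forall>t\<in>T. (f has_vector_derivative f' t) (at t within J)))"

text \<open>
  A path \<open>[a, b] \<rightarrow> M\<close> is given by \<open>a\<close>, \<open>b\<close> and an extensional function \<open>\<gamma>\<close>, so that two paths
  coincide iff their intervals and their values on them do.
\<close>

definition C1_path ::
    "('m::t2_space, 'e::real_normed_vector) chart set \<Rightarrow> real \<Rightarrow> real \<Rightarrow> (real \<Rightarrow> 'm) \<Rightarrow> bool" where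
  "C1_path A a b \<gamma> \<longleftrightarrow>
     a \<le> b \<and> \<gamma> \<in> extensional {a..b} \<and> continuous_on {a..b} \<gamma> \<and>
     (\<forall>(U, c)\<in>A. C1_within {a..b} {t\<in>{a..b}. \<gamma> t \<in> U} (c \<circ> \<gamma>))"


section \<open>The tensor algebra at a point\<close>

type_synonym ('m, 'e) tvec = "('m, 'e) chart \<Rightarrow> 'e"
type_synonym ('m, 'e) covec = "('m, 'e) tvec \<Rightarrow> real"
type_synonym ('m, 'e) tensor = "('m, 'e) covec list \<Rightarrow> ('m, 'e) tvec list \<Rightarrow> real"

text \<open>
  A tangent vector at \<open>x\<close> assigns to each chart around \<open>x\<close> its component in that chart; the
  components are related by the derivatives of the coordinate changes.
\<close>

definition tangent_space ::
    "('m::t2_space, 'e::real_normed_vector) chart set \<Rightarrow> 'm \<Rightarrow> ('m, 'e) tvec set" where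
  "tangent_space A x =
     {v. (\<forall>p. p \<notin> A \<or> x \<notin> fst p \<longrightarrow> v p = 0) \<and>
         (\<forall>(U, c)\<in>A. \<forall>(V, d)\<in>A. x \<in> U \<and> x \<in> V \<longrightarrow>
            v (V, d) = frechet_derivative (\<lambda>y. d (inv_into U c y)) (at (c x)) (v (U, c)))}"

definition cotangent_space ::
    "('m::t2_space, 'e::real_normed_vector) chart set \<Rightarrow> 'm \<Rightarrow> ('m, 'e) covec set" where
  "cotangent_space A x =
     {\<omega>. linear_on (tangent_space A x) \<omega> \<and> (\<forall>v. v \<notin> tangent_space A x \<longrightarrow> \<omega> v = 0)}"

text \<open>
  Tensors with \<open>p\<close> contravariant and \<open>q\<close> covariant indices: real functions of \<open>p\<close> covectors and \<open>q\<close>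
  vectors at \<open>x\<close>, linear in each of them, and set to 0 on all other lists of arguments.
\<close>

definition tensors ::
    "('m::t2_space, 'e::real_normed_vector) chart set \<Rightarrow> 'm \<Rightarrow> nat \<Rightarrow> nat \<Rightarrow> ('m, 'e) tensor set" where
  "tensors A x p q =
     {X. (\<forall>\<omega>s vs. X \<omega>s vs \<noteq> 0 \<longrightarrow>
            length \<omega>s = p \<and> length vs = q \<and>
            set \<omega>s \<subseteq> cotangent_space A x \<and> set vs \<subseteq> tangent_space A x) \<and>
         (\<forall>\<omega>s vs. length \<omega>s = p \<and> length vs = q \<and>
            set \<omega>s \<subseteq> cotangent_space A x \<and> set vs \<subseteq> tangent_space A x \<longrightarrow>
            (\<forall>i<p. linear_on (cotangent_space A x) (\<lambda>\<omega>. X (\<omega>s[i := \<omega>]) vs)) \<and>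
            (\<forall>j<q. linear_on (tangent_space A x) (\<lambda>v. X \<omega>s (vs[j := v]))))}"

text \<open>
  The tensor types have disjoint sets of argument lists, hence the span is the direct sum of the
  spaces \<open>tensors A x p q\<close>. The component of type \<open>(p, q)\<close> of \<open>X\<close> is its restriction to lists of
  lengths \<open>p\<close> and \<open>q\<close>.
\<close>

definition tensor_algebra ::
    "('m::t2_space, 'e::real_normed_vector) chart set \<Rightarrow> 'm \<Rightarrow> ('m, 'e) tensor set" where
  "tensor_algebra A x = span (\<Union>p q. tensors A x p q)"

definition scalar_tensor :: "real \<Rightarrow> ('m, 'e) tensor" where
  "scalar_tensor r = (\<lambda>\<omega>s vs. if \<omega>s = [] \<and> vs = [] then r else 0)"

text \<open>
  For \<open>X\<close> of type \<open>(p, q)\<close> only the summand \<open>i = p\<close>, \<open>j = q\<close> can be different from 0; the double sum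
  is the bilinear extension to inhomogeneous elements.
\<close>

definition tensor_product :: "('m, 'e) tensor \<Rightarrow> ('m, 'e) tensor \<Rightarrow> ('m, 'e) tensor"
    (infixr "\<otimes>\<^sub>T" 75) where
  "X \<otimes>\<^sub>T Y = (\<lambda>\<omega>s vs. \<Sum>i\<le>length \<omega>s. \<Sum>j\<le>length vs.
      X (take i \<omega>s) (take j vs) * Y (drop i \<omega>s) (drop j vs))"

definition insert_at :: "nat \<Rightarrow> 'a \<Rightarrow> 'a list \<Rightarrow> 'a list" where
  "insert_at i y xs = take i xs @ y # drop i xs"

definition tangent_basis ::
    "('m::t2_space, 'e::real_normed_vector) chart set \<Rightarrow> 'm \<Rightarrow> ('m, 'e) tvec set" where
  "tangent_basis A x = (SOME B. independent B \<and> span B = tangent_space A x)"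

text \<open>
  Contraction of the contravariant index \<open>i\<close> with the covariant index \<open>j\<close> (counted from 0), by
  means of a basis of the tangent space and the dual basis \<open>\<lambda>v. representation B v e\<close>, \<open>e \<in> B\<close>; the
  result does not depend on the basis. It maps type \<open>(p + 1, q + 1)\<close> to type \<open>(p, q)\<close> if \<open>i \<le> p\<close>
  and \<open>j \<le> q\<close>, and components that do not have these indices are mapped to 0.
\<close>

definition contraction ::
    "('m::t2_space, 'e::real_normed_vector) chart set \<Rightarrow> 'm \<Rightarrow> nat \<Rightarrow> nat
      \<Rightarrow> ('m, 'e) tensor \<Rightarrow> ('m, 'e) tensor" where
  "contraction A x i j X = (\<lambda>\<omega>s vs.
     if i \<le> length \<omega>s \<and> j \<le> length vs
     then (\<Sum>e\<in>tangent_basis A x.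
             X (insert_at i (\<lambda>v. representation (tangent_basis A x) v e) \<omega>s) (insert_at j e vs))
     else 0)"


section \<open>Diffeomorphisms between fibres\<close>

text \<open>
  The tensor algebra at a point is in general an infinite-dimensional real vector space without a
  distinguished norm. A linear space \<open>V\<close> is considered here with its finest locally convex
  topology, for which all linear functionals are continuous, and smoothness is that of the
  convenient calculus of Froelicher, Kriegl and Michor: a curve is smooth iff its compositions with
  the continuous linear functionals are, and a map is smooth iff it preserves smooth curves. On
  finite-dimensional spaces this is the usual notion of a \<open>C^\<infinity>\<close> map, by Boman's theorem.
\<close>

definition smooth_curve :: "'a::real_vector set \<Rightarrow> (real \<Rightarrow> 'a) \<Rightarrow> bool" where
  "smooth_curve V c \<longleftrightarrow>
     range c \<subseteq> V \<and> (\<forall>l :: 'a \<Rightarrow> real. linear_on V l \<longrightarrow> (\<forall>n. Ck_on n UNIV (l \<circ> c)))"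

definition smooth_map ::
    "'a::real_vector set \<Rightarrow> 'b::real_vector set \<Rightarrow> ('a \<Rightarrow> 'b) \<Rightarrow> bool" where
  "smooth_map V W f \<longleftrightarrow> f ` V \<subseteq> W \<and> (\<forall>c. smooth_curve V c \<longrightarrow> smooth_curve W (f \<circ> c))"

definition Diff :: "'a::real_vector set \<Rightarrow> 'b::real_vector set \<Rightarrow> ('a \<Rightarrow> 'b) set" where
  "Diff V W = {f. bij_betw f V W \<and> smooth_map V W f \<and> smooth_map W V (inv_into V f)}"


section \<open>Transports\<close>

text \<open>
  \<open>S a b \<gamma> s t\<close> is the map from the fibre over \<open>\<gamma> s\<close> to the one over \<open>\<gamma> t\<close> for the path
  \<open>\<gamma>: [a, b] \<rightarrow> M\<close>. Only its values on the fibre over \<open>\<gamma> s\<close>, for \<open>C^1\<close> paths and \<open>s, t \<in> [a, b]\<close>,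
  are meaningful.
\<close>

type_synonym ('m, 'e) transport =
  "real \<Rightarrow> real \<Rightarrow> (real \<Rightarrow> 'm) \<Rightarrow> real \<Rightarrow> real \<Rightarrow> ('m, 'e) tensor \<Rightarrow> ('m, 'e) tensor"

definition S_transport ::
    "('m::t2_space, 'e::real_normed_vector) chart set \<Rightarrow> ('m, 'e) transport \<Rightarrow> bool" where
  "S_transport A S \<longleftrightarrow>
     (\<forall>a b \<gamma>. C1_path A a b \<gamma> \<longrightarrow>
        (\<forall>s\<in>{a..b}. \<forall>t\<in>{a..b}.
           S a b \<gamma> s t ` tensor_algebra A (\<gamma> s) \<subseteq> tensor_algebra A (\<gamma> t) \<and>
           linear_on (tensor_algebra A (\<gamma> s)) (S a b \<gamma> s t) \<and>
           (\<forall>X\<in>tensor_algebra A (\<gamma> s). \<forall>Y\<in>tensor_algebra A (\<gamma> s).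
              S a b \<gamma> s t (X \<otimes>\<^sub>T Y) = S a b \<gamma> s t X \<otimes>\<^sub>T S a b \<gamma> s t Y) \<and>
           (\<forall>p q i j. i \<le> p \<and> j \<le> q \<longrightarrow> (\<forall>X\<in>tensors A (\<gamma> s) (Suc p) (Suc q).
              S a b \<gamma> s t (contraction A (\<gamma> s) i j X) =
              contraction A (\<gamma> t) i j (S a b \<gamma> s t X))) \<and>
           (\<forall>r. S a b \<gamma> s t (scalar_tensor r) = scalar_tensor r)) \<and>
        (\<forall>r\<in>{a..b}. \<forall>s\<in>{a..b}. \<forall>t\<in>{a..b}. \<forall>X\<in>tensor_algebra A (\<gamma> s).
           S a b \<gamma> t r (S a b \<gamma> s t X) = S a b \<gamma> s r X) \<and>
        (\<forall>s\<in>{a..b}. \<forall>X\<in>tensor_algebra A (\<gamma> s). S a b \<gamma> s s X = X))"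

type_synonym ('m, 'e) path_map =
  "real \<Rightarrow> real \<Rightarrow> (real \<Rightarrow> 'm) \<Rightarrow> ('m, 'e) tensor \<Rightarrow> ('m, 'e) tensor"

definition S_parallel_transport :: "('m, 'e) transport \<Rightarrow> ('m, 'e) path_map" where
  "S_parallel_transport S = (\<lambda>a b \<gamma>. S a b \<gamma> a b)"

text \<open>The diffeomorphisms of intervals are of class \<open>C^1\<close>, like the paths they reparametrize.\<close>

definition orientation_preserving_diffeo ::
    "real \<Rightarrow> real \<Rightarrow> real \<Rightarrow> real \<Rightarrow> (real \<Rightarrow> real) \<Rightarrow> bool" where
  "orientation_preserving_diffeo c d a b \<tau> \<longleftrightarrow>
     bij_betw \<tau> {c..d} {a..b} \<and> strict_mono_on {c..d} \<tau> \<and>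
     C1_within {c..d} {c..d} \<tau> \<and> C1_within {a..b} {a..b} (inv_into {c..d} \<tau>)"

definition inverse_path :: "(real \<Rightarrow> 'm) \<Rightarrow> real \<Rightarrow> 'm" where
  "inverse_path \<gamma> = (\<lambda>s\<in>{0..1}. \<gamma> (1 - s))"

definition product_path :: "(real \<Rightarrow> 'm) \<Rightarrow> (real \<Rightarrow> 'm) \<Rightarrow> real \<Rightarrow> 'm" where
  "product_path \<gamma>1 \<gamma>2 = (\<lambda>s\<in>{0..1}. if s \<le> 1/2 then \<gamma>1 (2 * s) else \<gamma>2 (2 * s - 1))"

text \<open>
  The product of two \<open>C^1\<close> paths may have a corner at \<open>1/2\<close>; the product axiom concerns the case in
  which it is again a \<open>C^1\<close> path, so that the transport along it is defined.
\<close>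

definition axiomatic_parallel_transport ::
    "('m::t2_space, 'e::real_normed_vector) chart set \<Rightarrow> ('m, 'e) path_map \<Rightarrow> bool" where
  "axiomatic_parallel_transport A \<phi> \<longleftrightarrow>
     (\<forall>a b \<gamma>. C1_path A a b \<gamma> \<longrightarrow>
        \<phi> a b \<gamma> \<in> Diff (tensor_algebra A (\<gamma> a)) (tensor_algebra A (\<gamma> b))) \<and>
     (\<forall>a b c d \<gamma> \<tau>. C1_path A a b \<gamma> \<and> c \<le> d \<and> orientation_preserving_diffeo c d a b \<tau> \<longrightarrow>
        (\<forall>X\<in>tensor_algebra A (\<gamma> a). \<phi> c d (\<lambda>s\<in>{c..d}. \<gamma> (\<tau> s)) X = \<phi> a b \<gamma> X)) \<and>
     (\<forall>\<gamma>. C1_path A 0 1 \<gamma> \<longrightarrow>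
        (\<forall>X\<in>tensor_algebra A (\<gamma> 1).
           \<phi> 0 1 (inverse_path \<gamma>) X = inv_into (tensor_algebra A (\<gamma> 0)) (\<phi> 0 1 \<gamma>) X)) \<and>
     (\<forall>\<gamma>1 \<gamma>2. C1_path A 0 1 \<gamma>1 \<and> C1_path A 0 1 \<gamma>2 \<and> \<gamma>1 1 = \<gamma>2 0 \<and>
        C1_path A 0 1 (product_path \<gamma>1 \<gamma>2) \<longrightarrow>
        (\<forall>X\<in>tensor_algebra A (\<gamma>1 0).
           \<phi> 0 1 (product_path \<gamma>1 \<gamma>2) X = \<phi> 0 1 \<gamma>2 (\<phi> 0 1 \<gamma>1 X))) \<and>
     (\<forall>a x. \<forall>X\<in>tensor_algebra A x. \<phi> a a (\<lambda>s\<in>{a}. x) X = X)"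

end

theory Submission
  imports Defs
begin

text \<open>
  Each transport map is linear with a linear inverse, hence a diffeomorphism, because smooth curves
  are defined by means of linear functionals. The axioms (1)--(3) come from the reparametrization
  hypothesis, applied to \<open>\<tau>\<close>, to \<open>s \<mapsto> 1 - s\<close>, and, on the two halves of a product path, to
  \<open>s \<mapsto> 2 s\<close> and \<open>s \<mapsto> 2 s - 1\<close>.
\<close>

lemma subspace_tensor_algebra: "subspace (tensor_algebra A x)"
  unfolding tensor_algebra_def by (rule subspace_span)

text \<open>If \<open>l\<close> is a linear functional on \<open>W\<close>, then
  \<open>l \<circ> f\<close> is one on \<open>V\<close>. So smoothness of \<open>f \<circ> c\<close>
  is tested only by functionals that already test \<open>c\<close>.\<close>

lemma smooth_map_linear_on:
  assumes f: "linear_on V f" and im: "f ` V \<subseteq> W"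
  shows "smooth_map V W f"
proof -
  have "smooth_curve W (f \<circ> c)" if c: "smooth_curve V c" for c
  proof -
    have "Ck_on n UNIV (l \<circ> (f \<circ> c))" if "linear_on W l" for l :: "_ \<Rightarrow> real" and n
    proof -
      have "linear_on V (l \<circ> f)"
        using f im that unfolding linear_on_def image_subset_iff o_def by metis
      then have "Ck_on n UNIV ((l \<circ> f) \<circ> c)"
        using c unfolding smooth_curve_def by blast
      then show ?thesis by (simp add: comp_assoc)
    qed
    moreover have "range (f \<circ> c) \<subseteq> W"
      using c im unfolding smooth_curve_def by auto
    ultimately show ?thesis unfolding smooth_curve_def by blast
  qed
  then show ?thesis using im unfolding smooth_map_def by blast
qed

text \<open>Sums and multiples of preimages stay in the subspace \<open>V\<close>, where injectivity
  of \<open>f\<close> identifies them as the preimages wanted.\<close>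

lemma linear_on_inv_into:
  assumes V: "subspace V" and f: "linear_on V f" and bij: "bij_betw f V W"
  shows "linear_on W (inv_into V f)"
  unfolding linear_on_def
proof (intro conjI ballI allI)
  have inj: "inj_on f V" and W: "\<And>y. y \<in> W \<Longrightarrow> inv_into V f y \<in> V \<and> f (inv_into V f y) = y"
    using bij by (auto simp: bij_betw_def inv_into_into f_inv_into_f)
  show "inv_into V f (x + y) = inv_into V f x + inv_into V f y" if "x \<in> W" "y \<in> W" for x y
    using V W[OF that(1)] W[OF that(2)] f inj
    by (intro inv_into_f_eq) (auto simp: linear_on_def subspace_add)
  show "inv_into V f (r *\<^sub>R x) = r *\<^sub>R inv_into V f x" if "x \<in> W" for r x
    using V W[OF that] f inj
    by (intro inv_into_f_eq) (auto simp: linear_on_def subspace_scale)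
qed

lemma Diff_linear_on:
  assumes "subspace V" "linear_on V f" "bij_betw f V W"
  shows "f \<in> Diff V W"
proof -
  have "smooth_map V W f"
    using assms by (intro smooth_map_linear_on) (auto simp: bij_betw_def)
  moreover have "smooth_map W V (inv_into V f)"
    using linear_on_inv_into[OF assms] bij_betw_inv_into[OF assms(3)]
    by (intro smooth_map_linear_on) (auto simp: bij_betw_def)
  ultimately show ?thesis using assms(3) unfolding Diff_def by blast
qed

text \<open>This is the chain rule, applied in each chart. It supplies the \<open>C1_path\<close>
  premise on the composite path in the reparametrization hypothesis.\<close>

lemma C1_path_reparametrize:
  assumes \<gamma>: "C1_path A a b \<gamma>" and "c \<le> d" and im: "\<tau> ` {c..d} \<subseteq> {a..b}"
    and \<tau>: "C1_within {c..d} {c..d} \<tau>"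
  shows "C1_path A c d (\<lambda>s\<in>{c..d}. \<gamma> (\<tau> s))" (is "C1_path A c d ?\<delta>")
proof -
  obtain \<tau>' where \<tau>'c: "continuous_on {c..d} \<tau>'"
    and \<tau>': "\<And>t. t \<in> {c..d} \<Longrightarrow> (\<tau> has_vector_derivative \<tau>' t) (at t within {c..d})"
    using \<tau> unfolding C1_within_def by blast
  have \<tau>c: "continuous_on {c..d} \<tau>"
    using has_vector_derivative_continuous[OF \<tau>']
    by (auto simp: continuous_on_eq_continuous_within)
  have "continuous_on {c..d} (\<gamma> \<circ> \<tau>)"
    using \<gamma> im \<tau>c continuous_on_subset unfolding C1_path_def
    by (intro continuous_on_compose) auto
  then have "continuous_on {c..d} ?\<delta>"
    by (rule continuous_on_eq) simp
  moreover have "C1_within {c..d} {t\<in>{c..d}. ?\<delta> t \<in> U} (h \<circ> ?\<delta>)" if "(U, h) \<in> A" for U h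
  proof -
    let ?T = "{t\<in>{c..d}. ?\<delta> t \<in> U}"
    obtain g where gc: "continuous_on {t\<in>{a..b}. \<gamma> t \<in> U} g"
      and g: "\<And>t. t \<in> {a..b} \<Longrightarrow> \<gamma> t \<in> U \<Longrightarrow>
        ((h \<circ> \<gamma>) has_vector_derivative g t) (at t within {a..b})"
      using \<gamma> \<open>(U, h) \<in> A\<close> unfolding C1_path_def C1_within_def by blast
    have T\<tau>: "\<tau> ` ?T \<subseteq> {t\<in>{a..b}. \<gamma> t \<in> U}"
      using im by (auto simp: image_subset_iff)
    have "continuous_on ?T \<tau>" "continuous_on ?T \<tau>'"
      using \<tau>c \<tau>'c by (auto intro: continuous_on_subset)
    then have "continuous_on ?T (\<lambda>t. \<tau>' t *\<^sub>R g (\<tau> t))"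
      using continuous_on_compose2[OF gc _ T\<tau>] by (intro continuous_intros) auto
    moreover have "((h \<circ> ?\<delta>) has_vector_derivative \<tau>' t *\<^sub>R g (\<tau> t)) (at t within {c..d})"
      if t: "t \<in> ?T" for t
    proof -
      \<comment> \<open>The chain rule within sets differentiates the outer map along the image of
        the inner one, so the derivative within \<open>{a..b}\<close> is first restricted to that
        image.\<close>
      have "((h \<circ> \<gamma>) has_vector_derivative g (\<tau> t)) (at (\<tau> t) within \<tau> ` {c..d})"
        using t T\<tau> by (intro has_vector_derivative_within_subset[OF g im]) auto
      then have "((h \<circ> \<gamma>) \<circ> \<tau> has_vector_derivative \<tau>' t *\<^sub>R g (\<tau> t)) (at t within {c..d})"
        using t \<tau>' by (intro vector_diff_chain_within) auto
      \<comment> \<open>The two functions agree on \<open>{c..d}\<close>, and a derivative within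
        that interval sees no other values.\<close>
      then show ?thesis
        by (rule has_vector_derivative_transform[rotated 2]) (use t in auto)
    qed
    ultimately show ?thesis unfolding C1_within_def by blast
  qed
  ultimately show ?thesis using \<open>c \<le> d\<close> unfolding C1_path_def by blast
qed

lemma C1_within_affine: "C1_within J T (\<lambda>t. m * t + n :: real)"
  unfolding C1_within_def
  by (intro exI[of _ "\<lambda>_. m"]) (auto intro!: derivative_eq_intros)

text \<open>Within a one-point set every linear map is a derivative, so 0 serves in every
  chart.\<close>

lemma C1_path_singleton: "C1_path A a a (\<lambda>s\<in>{a}. x)"
  unfolding C1_path_def C1_within_def
  by (auto simp: has_vector_derivative_def has_derivative_within_singleton_iff
      intro!: exI[of _ "\<lambda>_. 0"])

text \<open>This is where orientation enters axiom (1): the transport from \<open>\<tau> c\<close>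
  to \<open>\<tau> d\<close> becomes the one from \<open>a\<close> to \<open>b\<close>.\<close>

lemma strict_mono_on_bij_betw_endpoints:
  fixes \<tau> :: "real \<Rightarrow> real"
  assumes "strict_mono_on {c..d} \<tau>" "bij_betw \<tau> {c..d} {a..b}" "c \<le> d" "a \<le> b"
  shows "\<tau> c = a" "\<tau> d = b"
proof -
  have im: "\<tau> ` {c..d} = {a..b}" using assms(2) by (simp add: bij_betw_def)
  have mono: "\<tau> s \<le> \<tau> t" if "s \<in> {c..d}" "t \<in> {c..d}" "s \<le> t" for s t
    using strict_mono_on_leD[OF assms(1)] that by blast
  obtain s t where "s \<in> {c..d}" "t \<in> {c..d}" "\<tau> s = a" "\<tau> t = b"
    using im assms(4) by (metis atLeastAtMost_iff imageE order_refl)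
  moreover have "\<tau> c \<in> {a..b}" "\<tau> d \<in> {a..b}" using im assms(3) by auto
  \<comment> \<open>Monotonicity gives \<open>\<tau> c \<le> \<tau> s = a\<close> and
    \<open>b = \<tau> t \<le> \<tau> d\<close>; the range of \<open>\<tau>\<close> gives the
    opposite inequalities.\<close>
  ultimately show "\<tau> c = a" "\<tau> d = b"
    using mono[of c s] mono[of t d] assms(3) by auto
qed

lemma S_transportD:
  assumes "S_transport A S" "C1_path A a b \<gamma>" "s \<in> {a..b}" "t \<in> {a..b}"
  shows "X \<in> tensor_algebra A (\<gamma> s) \<Longrightarrow> S a b \<gamma> s t X \<in> tensor_algebra A (\<gamma> t)"
    and "linear_on (tensor_algebra A (\<gamma> s)) (S a b \<gamma> s t)"
    and "r \<in> {a..b} \<Longrightarrow> X \<in> tensor_algebra A (\<gamma> s) \<Longrightarrow>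
      S a b \<gamma> t r (S a b \<gamma> s t X) = S a b \<gamma> s r X"
    and "X \<in> tensor_algebra A (\<gamma> s) \<Longrightarrow> S a b \<gamma> s s X = X"
  using assms unfolding S_transport_def image_subset_iff by simp_all

text \<open>The transport back from \<open>t\<close> to \<open>s\<close> is a two-sided inverse, by
  the composition law and the identity law.\<close>

lemma S_transport_bij_betw:
  assumes "S_transport A S" "C1_path A a b \<gamma>" "s \<in> {a..b}" "t \<in> {a..b}"
  shows "bij_betw (S a b \<gamma> s t) (tensor_algebra A (\<gamma> s)) (tensor_algebra A (\<gamma> t))"
  using assms by (intro bij_betw_byWitness[where f' = "S a b \<gamma> t s"]) (auto simp: S_transportD)

lemma S_transport_inv_into:
  assumes "S_transport A S" "C1_path A a b \<gamma>" "s \<in> {a..b}" "t \<in> {a..b}"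
    and "X \<in> tensor_algebra A (\<gamma> t)"
  shows "inv_into (tensor_algebra A (\<gamma> s)) (S a b \<gamma> s t) X = S a b \<gamma> t s X"
  using assms S_transport_bij_betw[OF assms(1-4)]
  by (intro inv_into_f_eq) (auto simp: S_transportD bij_betw_def)

text \<open>Needed for the maps that stretch each half of \<open>[0,1]\<close> to the whole
  interval.\<close>

lemma bij_betw_affine:
  fixes m n :: real
  assumes "m > 0"
  shows "bij_betw (\<lambda>t. m * t + n) {c..d} {m * c + n..m * d + n}"
  using assms
  by (intro bij_betw_byWitness[where f' = "\<lambda>t. (t - n) / m"]) (auto simp: field_simps)

theorem proposition4p5:
  fixes A :: "('m::t2_space, 'e::real_normed_vector) chart set"
    and k :: enat
    and S :: "('m, 'e) transport"
  assumes manifold: "differentiable_manifold k A"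
    and transport: "S_transport A S"
    and restriction: "\<And>a b \<gamma> a' b' s t X.
      C1_path A a b \<gamma> \<Longrightarrow> a \<le> a' \<Longrightarrow> a' \<le> b' \<Longrightarrow> b' \<le> b \<Longrightarrow>
      s \<in> {a'..b'} \<Longrightarrow> t \<in> {a'..b'} \<Longrightarrow> X \<in> tensor_algebra A (\<gamma> s) \<Longrightarrow>
      S a' b' (restrict \<gamma> {a'..b'}) s t X = S a b \<gamma> s t X"
    and reparametrization: "\<And>a b \<gamma> c d \<tau> s t X.
      C1_path A a b \<gamma> \<Longrightarrow> c \<le> d \<Longrightarrow> bij_betw \<tau> {c..d} {a..b} \<Longrightarrow>
      C1_path A c d (\<lambda>r\<in>{c..d}. \<gamma> (\<tau> r)) \<Longrightarrow>
      s \<in> {c..d} \<Longrightarrow> t \<in> {c..d} \<Longrightarrow> X \<in> tensor_algebra A (\<gamma> (\<tau> s)) \<Longrightarrow>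
      S c d (\<lambda>r\<in>{c..d}. \<gamma> (\<tau> r)) s t X = S a b \<gamma> (\<tau> s) (\<tau> t) X"
  shows "axiomatic_parallel_transport A (S_parallel_transport S)"
proof -
  note T = S_transportD[OF transport]
  have rep: "S c d (\<lambda>r\<in>{c..d}. \<gamma> (\<tau> r)) s t X = S a b \<gamma> (\<tau> s) (\<tau> t) X"
    if "C1_path A a b \<gamma>" "c \<le> d" "bij_betw \<tau> {c..d} {a..b}" "C1_within {c..d} {c..d} \<tau>"
      "s \<in> {c..d}" "t \<in> {c..d}" "X \<in> tensor_algebra A (\<gamma> (\<tau> s))" for a b c d \<gamma> \<tau> s t X
    using that by (intro reparametrization C1_path_reparametrize) (auto simp: bij_betw_def)
  have diff: "S a b \<gamma> a b \<in> Diff (tensor_algebra A (\<gamma> a)) (tensor_algebra A (\<gamma> b))"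
    if \<gamma>: "C1_path A a b \<gamma>" for a b \<gamma>
  proof -
    have "a \<in> {a..b}" "b \<in> {a..b}" using \<gamma> by (auto simp: C1_path_def)
    then show ?thesis
      using T(2)[OF \<gamma>] S_transport_bij_betw[OF transport \<gamma>]
      by (intro Diff_linear_on subspace_tensor_algebra) auto
  qed
  have inverse: "S 0 1 (inverse_path \<gamma>) 0 1 X =
      inv_into (tensor_algebra A (\<gamma> 0)) (S 0 1 \<gamma> 0 1) X"
    if \<gamma>: "C1_path A 0 1 \<gamma>" and X: "X \<in> tensor_algebra A (\<gamma> 1)" for \<gamma> X
  proof -
    \<comment> \<open>The reparametrization hypothesis admits every bijection of the intervals,
      hence also this decreasing one, which exchanges the end points.\<close>
    have "bij_betw (\<lambda>s::real. 1 - s) {0..1} {0..1}"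
      by (intro bij_betw_byWitness[where f' = "\<lambda>s. 1 - s"]) auto
    then have "S 0 1 (inverse_path \<gamma>) 0 1 X = S 0 1 \<gamma> (1 - 0) (1 - 1) X"
      unfolding inverse_path_def using \<gamma> X C1_within_affine[of "{0..1}" "{0..1}" "-1" 1]
      by (intro rep) auto
    then show ?thesis using S_transport_inv_into[OF transport \<gamma>] X by simp
  qed
  have product: "S 0 1 (product_path \<gamma>1 \<gamma>2) 0 1 X = S 0 1 \<gamma>2 0 1 (S 0 1 \<gamma>1 0 1 X)"
    if \<gamma>1: "C1_path A 0 1 \<gamma>1" and \<gamma>2: "C1_path A 0 1 \<gamma>2" and eq: "\<gamma>1 1 = \<gamma>2 0"
      and \<gamma>: "C1_path A 0 1 (product_path \<gamma>1 \<gamma>2)" (is "C1_path A 0 1 ?\<gamma>")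
      and X: "X \<in> tensor_algebra A (\<gamma>1 0)" for \<gamma>1 \<gamma>2 X
  proof -
    \<comment> \<open>At \<open>1/2\<close> the product path takes its first branch, with value
      \<open>\<gamma>1 1\<close>; \<open>eq\<close> identifies this with the start of
      \<open>\<gamma>2\<close>.\<close>
    have vals: "?\<gamma> 0 = \<gamma>1 0" "?\<gamma> (1/2) = \<gamma>2 0" using eq by (auto simp: product_path_def)
    \<comment> \<open>The summands \<open>0\<close> and \<open>-1\<close> are kept so that the
      arguments have the shape \<open>m * s + n\<close> of the lemmas on affine maps.\<close>
    have r1: "restrict ?\<gamma> {0..1/2} = (\<lambda>s\<in>{0..1/2}. \<gamma>1 (2 * s + 0))"
      by (auto simp: product_path_def fun_eq_iff)
    have r2: "restrict ?\<gamma> {1/2..1} = (\<lambda>s\<in>{1/2..1}. \<gamma>2 (2 * s + -1))"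
      using eq by (auto simp: product_path_def fun_eq_iff) (simp add: mult.commute)
    have "S 0 1 ?\<gamma> 0 (1/2) X = S 0 (1/2) (restrict ?\<gamma> {0..1/2}) 0 (1/2) X"
      using \<gamma> X vals by (intro restriction[symmetric]) auto
    also have "\<dots> = S 0 1 \<gamma>1 (2 * 0 + 0) (2 * (1/2) + 0) X"
      unfolding r1 using \<gamma>1 X C1_within_affine[of "{0..1/2}" "{0..1/2}" 2 0]
        bij_betw_affine[of 2 0 0 "1/2"]
      by (intro rep) auto
    finally have first: "S 0 1 ?\<gamma> 0 (1/2) X = S 0 1 \<gamma>1 0 1 X" by simp
    have Y: "S 0 1 \<gamma>1 0 1 X \<in> tensor_algebra A (\<gamma>2 0)"
      using T(1)[OF \<gamma>1, of 0 1 X] X eq by simp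
    let ?Y = "S 0 1 \<gamma>1 0 1 X"
    have "S 0 1 ?\<gamma> (1/2) 1 ?Y = S (1/2) 1 (restrict ?\<gamma> {1/2..1}) (1/2) 1 ?Y"
      using \<gamma> Y vals by (intro restriction[symmetric]) auto
    also have "\<dots> = S 0 1 \<gamma>2 (2 * (1/2) + -1) (2 * 1 + -1) ?Y"
      unfolding r2 using \<gamma>2 Y C1_within_affine[of "{1/2..1}" "{1/2..1}" 2 "-1"]
        bij_betw_affine[of 2 "-1" "1/2" 1]
      by (intro rep) auto
    finally have second: "S 0 1 ?\<gamma> (1/2) 1 ?Y = S 0 1 \<gamma>2 0 1 ?Y" by simp
    show ?thesis
      \<comment> \<open>The composition law along the product path, split at \<open>1/2\<close>,
        joins the two halves.\<close>
      using T(3)[OF \<gamma>, of 0 "1/2" 1 X] X vals first second by simp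
  qed
  have reparam: "S c d (\<lambda>s\<in>{c..d}. \<gamma> (\<tau> s)) c d X = S a b \<gamma> a b X"
    if \<gamma>: "C1_path A a b \<gamma>" and "c \<le> d" and \<tau>: "orientation_preserving_diffeo c d a b \<tau>"
      and X: "X \<in> tensor_algebra A (\<gamma> a)" for a b c d \<gamma> \<tau> X
  proof -
    have ends: "\<tau> c = a" "\<tau> d = b"
      using strict_mono_on_bij_betw_endpoints[of c d \<tau> a b] \<gamma> \<tau> \<open>c \<le> d\<close>
      by (auto simp: orientation_preserving_diffeo_def C1_path_def)
    have "S c d (\<lambda>s\<in>{c..d}. \<gamma> (\<tau> s)) c d X = S a b \<gamma> (\<tau> c) (\<tau> d) X"
      using \<gamma> \<tau> X \<open>c \<le> d\<close> ends
      by (intro rep) (auto simp: orientation_preserving_diffeo_def)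
    then show ?thesis using ends by simp
  qed
  \<comment> \<open>On a one-point path the start and end parameters coincide, so axiom (4) is the
    identity law for \<open>S\<close>.\<close>
  have "S a a (\<lambda>s\<in>{a}. x) a a X = X" if "X \<in> tensor_algebra A x" for a x X
    using T(4)[OF C1_path_singleton, of a a a X x] that by simp
  with diff inverse product reparam show ?thesis
    unfolding axiomatic_parallel_transport_def S_parallel_transport_def by blast
qed

end
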